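(* Let $\mathcal{G}_0=(G_0,m,\varphi,\tau)$ be a $\Gamma$-gain framework. Then $$\Omega(\mathcal{G}_0)=\bigcup_{g\in\mathcal{T}(\mathcal{G}_0)}\Lambda(T_{\tilde\tau}^{-1}g).$$ Moreover, every $\chi$-symmetric vector of the form $z(\chi,\hat h(\chi))$, where $\chi\in\hat\Gamma$, $h\in AP(\Gamma,X^{V_0})$ and $T_{\tilde\tau}h\in\mathcal{T}(\mathcal{G}_0)$, is a bounded infinitesimal flex of $\mathcal{G}_0$.
   Context: $X$ and $Y$ are finite-dimensional complex Hilbert spaces; $\Gamma$ is a finitely generated discrete abelian group written additively; $\hat\Gamma$ is its dual group of characters $\chi:\Gamma\to\mathbb{T}$. $\mathrm{Isom}(X)$ is the group of affine isometries of $X$ (maps $x\mapsto Ux+b$ with $U$ a linear isometry, $b\in X$). For a group homomorphism $\tau:\Gamma\to\mathrm{Isom}(X)$, $d\tau(\gamma)$ denotes the linear part of $\tau(\gamma)$; $d\tau$ is a unitary representation of $\Gamma$ on $X$. A $\Gamma$-gain framework is a tuple $\mathcal{G}_0=(G_0,m,\varphi,\tau)$ where $G_0=(V_0,E_0)$ is a finite directed multigraph with $V_0\ne\emptyset$ (loops and parallel edges allowed), $m:E_0\to\Gamma$, $e\mapsto m_e$, is any map, $\varphi=(\varphi_e)_{e\in E_0}$ is a family of linear maps $X\to Y$, and $\tau:\Gamma\to\mathrm{Isom}(X)$ is a group homomorphism. The source and range of $e\in E_0$ are denoted $s(e)$ and $r(e)$. For $\chi\in\hat\Gamma$ the orbit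 matrix is the linear map $O_{\mathcal{G}_0}(\chi):X^{V_0}\to Y^{E_0}$ given by $(O_{\mathcal{G}_0}(\chi)a)_e=\varphi_e\big(a_{s(e)}-\chi(m_e)\,d\tau(m_e)a_{r(e)}\big)$ for $e\in E_0$. The RUM spectrum is $\Omega(\mathcal{G}_0)=\{\chi\in\hat\Gamma:\ker O_{\mathcal{G}_0}(\chi)\ne\{0\}\}$. For a finite-dimensional complex Hilbert space $Z$, $\ell^\infty(\Gamma,Z)$ is the Banach space of bounded functions $\Gamma\to Z$ with the supremum norm. The gain framework operator $\tilde C(\mathcal{G}_0):\ell^\infty(\Gamma,X^{V_0})\to\ell^\infty(\Gamma,Y^{E_0})$ is $(\tilde C(\mathcal{G}_0)f)(\gamma)=\big(\varphi_e\circ d\tau(-\gamma)(f(\gamma)_{s(e)}-f(\gamma+m_e)_{r(e)})\big)_{e\in E_0}$. A bounded infinitesimal flex of $\mathcal{G}_0$ is an $f\in\ell^\infty(\Gamma,X^{V_0})$ with $\tilde C(\mathcal{G}_0)f=0$. The isometric isomorphism $T_{\tilde\tau}$ of $\ell^\infty(\Gamma,X^{V_0})$ is $(T_{\tilde\tau}f)(\gamma)=(d\tau(\gamma)f(\gamma)_v)_{v\in V_0}$. For $\chi\in\hat\Gamma$ and $a\in X^{V_0}$, the $\chi$-symmetric vector $z(\chi,a)$ is $z(\chi,a)(\gamma)=(\chi(\gamma)d\tau(\gamma)a_v)_{v\in V_0}$. $AP(\Gamma,Z)$ (the $Z$-valued almost periodic functions) is the closure in $\ell^\infty(\Gamma,Z)$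 of the $Z$-valued trigonometric polynomials $\gamma\mapsto\sum_{k=1}^n\chi_k(\gamma)a_k$ with $\chi_k\in\hat\Gamma$, $a_k\in Z$. A Bohr-Bochner sequence for $\Gamma$ is an increasing sequence $(H_n)$ of finite non-empty subsets of $\Gamma$ with $\Gamma=\bigcup_nH_n$ and $\lim_n|(\gamma+H_n)\setminus H_n|/|H_n|=0$ for every $\gamma\in\Gamma$ (such sequences exist). For $h\in AP(\Gamma,Z)$ and $\chi\in\hat\Gamma$ the Fourier coefficient is $\hat h(\chi)=\lim_{n\to\infty}\frac1{|H_n|}\sum_{\gamma\in H_n}\overline{\chi(\gamma)}h(\gamma)\in Z$; the limit exists and is independent of $(H_n)$. The Bohr-Fourier spectrum of $h$ is $\Lambda(h)=\{\chi\in\hat\Gamma:\hat h(\chi)\ne0\}$. A twisted almost periodic flex of $\mathcal{G}_0$ is a function of the form $T_{\tilde\tau}h$ with $h\in AP(\Gamma,X^{V_0})$ which is also a bounded infinitesimal flex of $\mathcal{G}_0$; $\mathcal{T}(\mathcal{G}_0)$ denotes the space of all twisted almost periodic flexes of $\mathcal{G}_0$. *)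

theory Defs
  imports
    "HOL-Analysis.Analysis"
    "HOL-Computational_Algebra.Group_Closure"
    "Graph_Theory.Digraph"
begin

section \<open>Finite-dimensional complex Hilbert spaces\<close>

text \<open>The complex inner product is linear in its first argument.
  Since \<open>norm_sq_eq_cinner\<close> refers to the norm of a \<^class>\<open>real_normed_vector\<close>, positive
  definiteness of \<open>cinner\<close> is built in.\<close>

class complex_inner_space = real_normed_vector +
  fixes scaleC :: "complex \<Rightarrow> 'a \<Rightarrow> 'a" (infixr \<open>*\<^sub>C\<close> 75)
    and cinner :: "'a \<Rightarrow> 'a \<Rightarrow> complex"
  assumes scaleC_add_right: "c *\<^sub>C (x + y) = c *\<^sub>C x + c *\<^sub>C y"
    and scaleC_add_left: "(c + d) *\<^sub>C x = c *\<^sub>C x + d *\<^sub>C x"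
    and scaleC_scaleC: "c *\<^sub>C (d *\<^sub>C x) = (c * d) *\<^sub>C x"
    and scaleC_of_real: "complex_of_real r *\<^sub>C x = r *\<^sub>R x"
    and cinner_add_left: "cinner (x + y) z = cinner x z + cinner y z"
    and cinner_scaleC_left: "cinner (c *\<^sub>C x) y = c * cinner x y"
    and cinner_commute: "cinner x y = cnj (cinner y x)"
    and norm_sq_eq_cinner: "complex_of_real ((norm x)\<^sup>2) = cinner x x"

class fd_complex_hilbert = complex_inner_space + banach +
  assumes finite_dimensional: "\<exists>B. finite B \<and> (\<forall>x. \<exists>r. x = (\<Sum>b\<in>B. r b *\<^sub>C b))"

interpretation scaleC: vector_space "scaleC :: complex \<Rightarrow> 'a \<Rightarrow> 'a::complex_inner_space"
proof
  fix x :: 'a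
  show "1 *\<^sub>C x = x" using scaleC_of_real[of 1 x] by simp
qed (simp_all add: scaleC_add_right scaleC_add_left scaleC_scaleC)

abbreviation clinear :: "('a::complex_inner_space \<Rightarrow> 'b::complex_inner_space) \<Rightarrow> bool" where
  "clinear \<equiv> Vector_Spaces.linear scaleC scaleC"

lemma norm_scaleC: "norm (c *\<^sub>C x) = cmod c * norm (x::'a::complex_inner_space)"
proof -
  have right: "cinner x (c *\<^sub>C y) = cnj c * cinner x y" for x y :: 'a
    by (subst cinner_commute) (simp add: cinner_scaleC_left cinner_commute[of x y])
  have "complex_of_real ((norm (c *\<^sub>C x))\<^sup>2) = c * cnj c * complex_of_real ((norm x)\<^sup>2)"
    by (simp only: norm_sq_eq_cinner cinner_scaleC_left right mult.assoc mult.left_commute)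
  also have "\<dots> = complex_of_real ((cmod c * norm x)\<^sup>2)"
    by (simp only: complex_norm_square[symmetric] power_mult_distrib of_real_mult)
  finally have "(norm (c *\<^sub>C x))\<^sup>2 = (cmod c * norm x)\<^sup>2"
    by (simp only: of_real_eq_iff)
  then show ?thesis by (simp add: power2_eq_iff_nonneg)
qed

text \<open>The space \<open>\<complex>\<close>, and the direct sum \<open>X\<^sup>V\<close> as \<open>X ^ 'v\<close> with the inner product
  that induces the norm already present on that type.\<close>

instantiation complex :: fd_complex_hilbert
begin

definition scaleC_complex :: "complex \<Rightarrow> complex \<Rightarrow> complex" where
  "scaleC_complex c x = c * x"

definition cinner_complex :: "complex \<Rightarrow> complex \<Rightarrow> complex" where
  "cinner_complex x y = x * cnj y"

instance
proof
  fix c d x y z :: complex and r :: real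
  show "c *\<^sub>C (x + y) = c *\<^sub>C x + c *\<^sub>C y" "(c + d) *\<^sub>C x = c *\<^sub>C x + d *\<^sub>C x"
    "c *\<^sub>C (d *\<^sub>C x) = (c * d) *\<^sub>C x" "complex_of_real r *\<^sub>C x = r *\<^sub>R x"
    "cinner (x + y) z = cinner x z + cinner y z" "cinner (c *\<^sub>C x) y = c * cinner x y"
    "cinner x y = cnj (cinner y x)"
    by (simp_all add: scaleC_complex_def cinner_complex_def algebra_simps scaleR_conv_of_real)
  show "complex_of_real ((norm x)\<^sup>2) = cinner x x"
    by (simp only: cinner_complex_def complex_norm_square)
next
  show "\<exists>B. finite B \<and> (\<forall>x::complex. \<exists>r. x = (\<Sum>b\<in>B. r b *\<^sub>C b))"
  proof (intro exI conjI allI)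
    show "x = (\<Sum>b\<in>{1}. x *\<^sub>C b)" for x :: complex
      by (simp add: scaleC_complex_def)
  qed simp
qed

end

instantiation vec :: (complex_inner_space, finite) complex_inner_space
begin

definition scaleC_vec :: "complex \<Rightarrow> 'a ^ 'b \<Rightarrow> 'a ^ 'b" where
  "c *\<^sub>C x = (\<chi> i. c *\<^sub>C (x $ i))"

definition cinner_vec :: "'a ^ 'b \<Rightarrow> 'a ^ 'b \<Rightarrow> complex" where
  "cinner x y = (\<Sum>i\<in>UNIV. cinner (x $ i) (y $ i))"

instance
proof
  fix c d :: complex and x y z :: "'a ^ 'b" and r :: real
  show "c *\<^sub>C (x + y) = c *\<^sub>C x + c *\<^sub>C y" "(c + d) *\<^sub>C x = c *\<^sub>C x + d *\<^sub>C x"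
    "c *\<^sub>C (d *\<^sub>C x) = (c * d) *\<^sub>C x" "complex_of_real r *\<^sub>C x = r *\<^sub>R x"
    by (simp_all add: scaleC_vec_def vec_eq_iff scaleC_add_right scaleC_add_left
        scaleC_scaleC scaleC_of_real)
  show "cinner (x + y) z = cinner x z + cinner y z" "cinner (c *\<^sub>C x) y = c * cinner x y"
    by (simp_all add: cinner_vec_def scaleC_vec_def cinner_add_left cinner_scaleC_left
        sum.distrib sum_distrib_left)
  show "cinner x y = cnj (cinner y x)"
    by (auto simp: cinner_vec_def intro!: sum.cong cinner_commute)
  have "(norm x)\<^sup>2 = (\<Sum>i\<in>UNIV. (norm (x $ i))\<^sup>2)"
    by (simp add: norm_vec_def L2_set_def sum_nonneg)
  then show "complex_of_real ((norm x)\<^sup>2) = cinner x x"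
    by (simp add: cinner_vec_def norm_sq_eq_cinner[symmetric])
qed

end

instance vec :: (fd_complex_hilbert, finite) fd_complex_hilbert
proof
  obtain B :: "'a set" where B: "finite B" "\<And>x. \<exists>r. x = (\<Sum>b\<in>B. r b *\<^sub>C b)"
    using finite_dimensional by blast
  let ?B = "(\<lambda>(i, b). axis i b :: 'a ^ 'b) ` (UNIV \<times> B)"
  have axis: "axis i a \<in> scaleC.span ?B" for i :: 'b and a :: 'a
  proof -
    from B have "a \<in> scaleC.span B" by (auto simp: scaleC.span_finite)
    then show ?thesis
    proof (induction rule: scaleC.span_induct_alt)
      case base
      have "axis i (0::'a) = (0 :: 'a ^ 'b)" by simp
      then show ?case by (simp only: scaleC.span_zero)
    next
      case (step c b y)
      have "axis i (c *\<^sub>C b + y) = c *\<^sub>C axis i b + axis i y"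
        by (auto simp: axis_def vec_eq_iff scaleC_vec_def)
      moreover have "axis i b \<in> scaleC.span ?B"
        using step(1) by (intro scaleC.span_base image_eqI[of _ _ "(i, b)"]) auto
      ultimately show ?case
        using step(2) by (simp only: scaleC.span_add scaleC.span_scale)
    qed
  qed
  have sp: "x \<in> scaleC.span ?B" for x :: "'a ^ 'b"
  proof -
    have "x $ j = (\<Sum>i\<in>UNIV. axis i (x $ i)) $ j" for j
      by (simp add: axis_def)
    then have "x = (\<Sum>i\<in>UNIV. axis i (x $ i))"
      unfolding vec_eq_iff by blast
    also have "\<dots> \<in> scaleC.span ?B"
      by (intro scaleC.span_sum axis)
    finally show ?thesis .
  qed
  have fin: "finite ?B" using B(1) by simp
  have "x \<in> range (\<lambda>r. \<Sum>b\<in>?B. r b *\<^sub>C b)" for x :: "'a ^ 'b"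
    using sp[of x] unfolding scaleC.span_finite[OF fin] .
  with fin show "\<exists>B. finite B \<and> (\<forall>x::'a ^ 'b. \<exists>r. x = (\<Sum>b\<in>B. r b *\<^sub>C b))"
    by (intro exI[of _ ?B] conjI allI) (simp_all only: image_iff bex_UNIV)
qed


section \<open>Affine isometries and characters\<close>

definition Isom :: "('x::complex_inner_space \<Rightarrow> 'x) set" where
  "Isom = {A. \<exists>U b. clinear U \<and> (\<forall>x. norm (U x) = norm x) \<and> A = (\<lambda>x. U x + b)}"

definition linear_part :: "('x::complex_inner_space \<Rightarrow> 'x) \<Rightarrow> 'x \<Rightarrow> 'x" where
  "linear_part A = (\<lambda>x. A x - A 0)"

lemma linear_part_eq: "clinear U \<Longrightarrow> linear_part (\<lambda>x. U x + b) = U"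
  by (simp add: linear_part_def module_hom.zero[OF Vector_Spaces.linear.axioms(3)])

definition characters :: "('g::ab_group_add \<Rightarrow> complex) set" where
  "characters = {\<xi>. (\<forall>a b. \<xi> (a + b) = \<xi> a * \<xi> b) \<and> (\<forall>a. cmod (\<xi> a) = 1)}"

definition finitely_generated :: "'g::ab_group_add itself \<Rightarrow> bool" where
  "finitely_generated _ \<longleftrightarrow> (\<exists>S :: 'g set. finite S \<and> group_closure S = UNIV)"


section \<open>Almost periodic functions\<close>

text \<open>For \<open>\<Gamma>\<close> a type \<open>'g\<close> of class \<^class>\<open>discrete_topology\<close>, every function on \<open>'g\<close> is continuous,
  so \<open>'g \<Rightarrow>\<^sub>C 'z\<close> is the Banach space \<open>\<ell>\<^sup>\<infinity>(\<Gamma>, Z)\<close>.\<close>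

lemma discrete_bcontfun:
  "f \<in> bcontfun \<longleftrightarrow> bounded (range f)"
  for f :: "'g::discrete_topology \<Rightarrow> 'z::metric_space"
  by (auto simp: bcontfun_def continuous_on_open_vimage open_discrete)

lemma apply_Bcontfun_le:
  fixes f :: "'g::discrete_topology \<Rightarrow> 'z::real_normed_vector"
  assumes "\<And>\<gamma>. norm (f \<gamma>) \<le> K"
  shows "apply_bcontfun (Bcontfun f) = f"
proof -
  have "bounded (range f)"
    using assms by (auto simp: bounded_iff)
  then show ?thesis
    by (simp add: Bcontfun_inverse discrete_bcontfun)
qed

definition trig_polys :: "('g::{ab_group_add,discrete_topology} \<Rightarrow>\<^sub>C 'z::fd_complex_hilbert) set" where
  "trig_polys = {p :: 'g \<Rightarrow>\<^sub>C 'z. \<exists>(n::nat) \<xi> a. (\<forall>k\<in>{1..n}. \<xi> k \<in> characters) \<and>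
     (\<forall>\<gamma>. p \<gamma> = (\<Sum>k=1..n. \<xi> k \<gamma> *\<^sub>C a k))}"

definition AP :: "('g::{ab_group_add,discrete_topology} \<Rightarrow>\<^sub>C 'z::fd_complex_hilbert) set" where
  "AP = closure trig_polys"

definition bohr_bochner :: "(nat \<Rightarrow> 'g::ab_group_add set) \<Rightarrow> bool" where
  "bohr_bochner H \<longleftrightarrow> incseq H \<and> (\<forall>n. finite (H n) \<and> H n \<noteq> {}) \<and> (\<Union>n. H n) = UNIV \<and>
     (\<forall>\<gamma>. (\<lambda>n. real (card ((\<lambda>x. \<gamma> + x) ` H n - H n)) / real (card (H n))) \<longlonglongrightarrow> 0)"

text \<open>The Fourier coefficient is the common limit along all Bohr-Bochner sequences.\<close>

definition fourier_coeff ::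
  "('g::{ab_group_add,discrete_topology} \<Rightarrow>\<^sub>C 'z::fd_complex_hilbert) \<Rightarrow> ('g \<Rightarrow> complex) \<Rightarrow> 'z" where
  "fourier_coeff h \<xi> = (THE c. \<forall>H. bohr_bochner H \<longrightarrow>
     (\<lambda>n. (1 / real (card (H n))) *\<^sub>R (\<Sum>\<gamma>\<in>H n. cnj (\<xi> \<gamma>) *\<^sub>C h \<gamma>)) \<longlonglongrightarrow> c)"

definition bohr_fourier_spectrum ::
  "('g::{ab_group_add,discrete_topology} \<Rightarrow>\<^sub>C 'z::fd_complex_hilbert) \<Rightarrow> ('g \<Rightarrow> complex) set" where
  "bohr_fourier_spectrum h = {\<xi> \<in> characters. fourier_coeff h \<xi> \<noteq> 0}"


section \<open>Gain frameworks\<close>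

text \<open>The fields \<open>gain\<close>, \<open>edge_map\<close> and \<open>action\<close> are \<open>m\<close>, \<open>\<phi>\<close> and \<open>\<tau>\<close>. The source and range
  of an edge \<open>e\<close> are its tail and head.
  The vertex set is all of the finite type \<open>'v\<close>, so that \<open>X\<^sup>V\<close> is \<open>'x ^ 'v\<close>. The edge set may be empty
  and is therefore only a subset of \<open>'e\<close>; accordingly \<open>Y\<^sup>E\<close> is realised inside \<open>'y ^ 'e\<close>
  as the subspace of the vectors whose coordinates outside the edge set are zero.\<close>

record ('v, 'e, 'g, 'x, 'y) gain_framework =
  graph :: "('v, 'e) pre_digraph"
  gain :: "'e \<Rightarrow> 'g"
  edge_map :: "'e \<Rightarrow> 'x \<Rightarrow> 'y"
  action :: "'g \<Rightarrow> 'x \<Rightarrow> 'x"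

definition is_gain_framework ::
  "('v::finite, 'e::finite, 'g::ab_group_add, 'x::fd_complex_hilbert, 'y::fd_complex_hilbert)
     gain_framework \<Rightarrow> bool" where
  "is_gain_framework G \<longleftrightarrow>
     fin_digraph (graph G) \<and> verts (graph G) = UNIV \<and>
     (\<forall>e\<in>arcs (graph G). clinear (edge_map G e)) \<and>
     (\<forall>\<gamma>. action G \<gamma> \<in> Isom) \<and>
     (\<forall>a b. action G (a + b) = action G a \<circ> action G b)"

abbreviation source where "source G e \<equiv> tail (graph G) e"
abbreviation target where "target G e \<equiv> head (graph G) e"

definition dtau ::
  "('v, 'e, 'g, 'x::complex_inner_space, 'y) gain_framework \<Rightarrow> 'g \<Rightarrow> 'x \<Rightarrow> 'x" where
  "dtau G \<gamma> = linear_part (action G \<gamma>)"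

definition orbit_matrix ::
  "('v::finite, 'e::finite, 'g, 'x::fd_complex_hilbert, 'y::fd_complex_hilbert) gain_framework
    \<Rightarrow> ('g \<Rightarrow> complex) \<Rightarrow> 'x ^ 'v \<Rightarrow> 'y ^ 'e" where
  "orbit_matrix G \<xi> a = (\<chi> e. if e \<in> arcs (graph G)
     then edge_map G e (a $ source G e - \<xi> (gain G e) *\<^sub>C dtau G (gain G e) (a $ target G e))
     else 0)"

definition rum_spectrum ::
  "('v::finite, 'e::finite, 'g::ab_group_add, 'x::fd_complex_hilbert, 'y::fd_complex_hilbert)
    gain_framework \<Rightarrow> ('g \<Rightarrow> complex) set" where
  "rum_spectrum G = {\<xi> \<in> characters. {a. orbit_matrix G \<xi> a = 0} \<noteq> {0}}"

text \<open>The functions under \<open>Bcontfun\<close> in the following definitions are bounded for every gain framework,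
  since \<open>dtau\<close> is isometric, the edge maps are linear on a finite-dimensional space, and
  characters have modulus 1; see also the evaluation rules below.\<close>

definition gain_framework_operator ::
  "('v::finite, 'e::finite, 'g::{ab_group_add,discrete_topology}, 'x::fd_complex_hilbert,
    'y::fd_complex_hilbert) gain_framework \<Rightarrow> ('g \<Rightarrow>\<^sub>C ('x ^ 'v)) \<Rightarrow> ('g \<Rightarrow>\<^sub>C ('y ^ 'e))" where
  "gain_framework_operator G f = Bcontfun (\<lambda>\<gamma>. \<chi> e. if e \<in> arcs (graph G)
     then edge_map G e (dtau G (- \<gamma>) (f \<gamma> $ source G e - f (\<gamma> + gain G e) $ target G e))
     else 0)"

definition bounded_inf_flexes ::
  "('v::finite, 'e::finite, 'g::{ab_group_add,discrete_topology}, 'x::fd_complex_hilbert,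
    'y::fd_complex_hilbert) gain_framework \<Rightarrow> ('g \<Rightarrow>\<^sub>C ('x ^ 'v)) set" where
  "bounded_inf_flexes G = {f. gain_framework_operator G f = 0}"

definition twist ::
  "('v::finite, 'e, 'g::{ab_group_add,discrete_topology}, 'x::fd_complex_hilbert, 'y) gain_framework
    \<Rightarrow> ('g \<Rightarrow>\<^sub>C ('x ^ 'v)) \<Rightarrow> ('g \<Rightarrow>\<^sub>C ('x ^ 'v))" where
  "twist G f = Bcontfun (\<lambda>\<gamma>. \<chi> v. dtau G \<gamma> (apply_bcontfun f \<gamma> $ v))"

definition symmetric_vector ::
  "('v::finite, 'e, 'g::{ab_group_add,discrete_topology}, 'x::fd_complex_hilbert, 'y) gain_framework
    \<Rightarrow> ('g \<Rightarrow> complex) \<Rightarrow> 'x ^ 'v \<Rightarrow> ('g \<Rightarrow>\<^sub>C ('x ^ 'v))" where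
  "symmetric_vector G \<xi> a = Bcontfun (\<lambda>\<gamma>. \<chi> v. \<xi> \<gamma> *\<^sub>C dtau G \<gamma> (a $ v))"

lemma dtau_Isom:
  assumes "is_gain_framework G"
  shows "clinear (dtau G \<gamma>)" "norm (dtau G \<gamma> x) = norm x"
    and "action G \<gamma> x = dtau G \<gamma> x + action G \<gamma> 0"
proof -
  have "action G \<gamma> \<in> Isom"
    using assms by (simp add: is_gain_framework_def)
  then obtain U b where U: "clinear U" "\<forall>x. norm (U x) = norm x" "action G \<gamma> = (\<lambda>x. U x + b)"
    by (auto simp: Isom_def)
  then have "dtau G \<gamma> = U"
    by (simp add: dtau_def linear_part_eq)
  with U show "clinear (dtau G \<gamma>)" "norm (dtau G \<gamma> x) = norm x"
    by auto
  show "action G \<gamma> x = dtau G \<gamma> x + action G \<gamma> 0"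
    by (simp add: dtau_def linear_part_def)
qed

lemma dtau_add:
  assumes "is_gain_framework G"
  shows "dtau G (\<alpha> + \<beta>) x = dtau G \<alpha> (dtau G \<beta> x)"
proof -
  note act = dtau_Isom(3)[OF assms]
  have comp: "action G (\<alpha> + \<beta>) y = action G \<alpha> (action G \<beta> y)" for y
    using assms by (simp add: is_gain_framework_def)
  interpret A: Vector_Spaces.linear scaleC scaleC "dtau G \<alpha>"
    by (rule dtau_Isom(1)[OF assms])
  have "dtau G (\<alpha> + \<beta>) x = action G \<alpha> (action G \<beta> x) - action G \<alpha> (action G \<beta> 0)"
    by (simp add: dtau_def linear_part_def comp)
  also have "\<dots> = dtau G \<alpha> (action G \<beta> x - action G \<beta> 0)"
    using act[of \<alpha> "action G \<beta> x"] act[of \<alpha> "action G \<beta> 0"] by (simp add: A.diff)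
  also have "action G \<beta> x - action G \<beta> 0 = dtau G \<beta> x"
    by (simp add: dtau_def linear_part_def)
  finally show ?thesis .
qed

lemma dtau_zero:
  assumes "is_gain_framework G"
  shows "dtau G 0 x = x"
proof -
  interpret A: Vector_Spaces.linear scaleC scaleC "dtau G 0"
    by (rule dtau_Isom(1)[OF assms])
  have "norm (dtau G 0 x - x) = norm (dtau G 0 (dtau G 0 x - x))"
    by (simp add: dtau_Isom(2)[OF assms])
  also have "\<dots> = 0"
    by (simp add: A.diff dtau_add[OF assms, symmetric])
  finally show ?thesis by simp
qed

lemma norm_dtau_vec:
  assumes "is_gain_framework G"
  shows "norm (\<chi> v. dtau G \<gamma> (a $ v)) = norm a"
  by (simp add: norm_vec_def dtau_Isom(2)[OF assms])

lemma twist_apply: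
  assumes "is_gain_framework G"
  shows "twist G f \<gamma> = (\<chi> v. dtau G \<gamma> (apply_bcontfun f \<gamma> $ v))"
proof -
  have "norm (\<chi> v. dtau G \<gamma> (apply_bcontfun f \<gamma> $ v)) \<le> norm f" for \<gamma>
    by (simp add: norm_dtau_vec[OF assms] norm_bounded)
  then show ?thesis
    by (simp add: twist_def apply_Bcontfun_le[of _ "norm f"])
qed

lemma bij_twist:
  fixes G :: "('v::finite, 'e::finite, 'g::{ab_group_add,discrete_topology}, 'x::fd_complex_hilbert,
    'y::fd_complex_hilbert) gain_framework"
  assumes "is_gain_framework G"
  shows "bij (twist G)"
proof -
  have cancel: "dtau G \<gamma> (dtau G (- \<gamma>) x) = x" "dtau G (- \<gamma>) (dtau G \<gamma> x) = x" for \<gamma> x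
    by (simp_all add: dtau_add[OF assms, symmetric] dtau_zero[OF assms])
  define T where "T f = Bcontfun (\<lambda>\<gamma>. \<chi> v. dtau G (- \<gamma>) (apply_bcontfun f \<gamma> $ v))"
    for f :: "'g \<Rightarrow>\<^sub>C ('x ^ 'v)"
  have T: "apply_bcontfun (T f) \<gamma> = (\<chi> v. dtau G (- \<gamma>) (apply_bcontfun f \<gamma> $ v))" for f \<gamma>
  proof -
    have "norm (\<chi> v. dtau G (- \<gamma>) (apply_bcontfun f \<gamma> $ v)) \<le> norm f" for \<gamma>
      by (simp add: norm_dtau_vec[OF assms] norm_bounded)
    then show ?thesis
      by (simp add: T_def apply_Bcontfun_le[of _ "norm f"])
  qed
  show ?thesis
  proof (rule o_bij)
    show "T \<circ> twist G = id" "twist G \<circ> T = id"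
      by (auto intro!: ext bcontfun_eqI simp: T twist_apply[OF assms] cancel)
  qed
qed

lemma symmetric_vector_apply:
  assumes "is_gain_framework G" "\<xi> \<in> characters"
  shows "symmetric_vector G \<xi> a \<gamma> = (\<chi> v. \<xi> \<gamma> *\<^sub>C dtau G \<gamma> (a $ v))"
proof -
  have "norm (\<chi> v. \<xi> \<gamma> *\<^sub>C dtau G \<gamma> (a $ v)) \<le> norm a" for \<gamma>
    using assms(2) by (simp add: norm_vec_def norm_scaleC dtau_Isom(2)[OF assms(1)] characters_def)
  then show ?thesis
    by (simp add: symmetric_vector_def apply_Bcontfun_le[of _ "norm a"])
qed

definition twisted_ap_flexes ::
  "('v::finite, 'e::finite, 'g::{ab_group_add,discrete_topology}, 'x::fd_complex_hilbert,
    'y::fd_complex_hilbert) gain_framework \<Rightarrow> ('g \<Rightarrow>\<^sub>C ('x ^ 'v)) set" where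
  "twisted_ap_flexes G = twist G ` AP \<inter> bounded_inf_flexes G"

end

theory Submission
  imports Defs "HOL-Real_Asymp.Real_Asymp"
begin

text \<open>Untwisting turns the flex equation into the translation-equivariant condition
  \<open>\<phi>\<^sub>e (h(\<gamma>)\<^sub>s - d\<tau>(m\<^sub>e) h(\<gamma> + m\<^sub>e)\<^sub>r) = 0\<close> for all \<open>\<gamma>\<close>. Averaging it against \<open>cnj \<circ> \<xi>\<close> along a
  Bohr-Bochner sequence is compatible with the linear maps involved and turns the shift by
  \<open>m\<^sub>e\<close> into the factor \<open>\<xi>(m\<^sub>e)\<close>, so every Fourier coefficient of \<open>h\<close> at \<open>\<xi>\<close> lies in the
  kernel of the orbit matrix at \<open>\<xi>\<close>. Conversely a kernel vector \<open>a\<close> gives the flex twisted from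
  \<open>\<gamma> \<mapsto> \<xi>(\<gamma>) a\<close>, whose Fourier coefficient at \<open>\<xi>\<close> is \<open>a\<close>. A Bohr-Bochner sequence is found among
  the balls for a finite generating set: their cardinality grows polynomially, so for every
  \<open>j\<close> there are arbitrarily large radii at which enlarging the radius by \<open>j\<close> multiplies the
  cardinality by at most \<open>1 + \<epsilon>\<close>.\<close>

section \<open>Polynomial growth and the existence of Bohr-Bochner sequences\<close>

text \<open>If every step of length \<open>j\<close> beyond \<open>N\<close> gained more than the
  factor \<open>1 + \<epsilon>\<close>, then \<open>c\<close> would grow exponentially along
  \<open>N + k * j\<close>, against its polynomial bound.\<close>

lemma polynomial_growth_slow_step:
  fixes c :: "nat \<Rightarrow> real"
  assumes ge1: "\<And>n. 1 \<le> c n" and le: "\<And>n. c n \<le> (real n + 1) ^ d" and "0 < \<epsilon>"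
  shows "\<exists>n\<ge>N. c (n + j) \<le> (1 + \<epsilon>) * c n"
proof (rule ccontr)
  assume "\<not> ?thesis"
  then have step: "(1 + \<epsilon>) * c n < c (n + j)" if "n \<ge> N" for n
    using that by (metis not_le)
  have geom: "(1 + \<epsilon>) ^ k \<le> c (N + k * j)" for k
  proof (induction k)
    case 0
    show ?case using ge1[of N] by simp
  next
    case (Suc k)
    have "(1 + \<epsilon>) ^ Suc k \<le> (1 + \<epsilon>) * c (N + k * j)"
      using Suc \<open>0 < \<epsilon>\<close> by simp
    also have "\<dots> \<le> c (N + k * j + j)"
      using step[of "N + k * j"] by simp
    finally show ?case by (simp add: algebra_simps)
  qed
  \<comment> \<open>With this constant \<open>N + k * j + 1 \<le> M * (k + 1)\<close>, so the
    polynomial bound at \<open>N + k * j\<close> becomes one in \<open>k\<close> alone, which is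
    compared with the geometric lower bound.\<close>
  define M where "M = real N + real j + 1"
  have "M > 0" by (simp add: M_def)
  have upper: "(1 + \<epsilon>) ^ k \<le> (M * (real k + 1)) ^ d" for k
  proof -
    have "(1 + \<epsilon>) ^ k \<le> (real (N + k * j) + 1) ^ d"
      using geom[of k] le[of "N + k * j"] by linarith
    also have "\<dots> \<le> (M * (real k + 1)) ^ d"
      by (rule power_mono) (auto simp: M_def algebra_simps)
    finally show ?thesis .
  qed
  have "(\<lambda>k. (M * (real k + 1)) ^ d / (1 + \<epsilon>) ^ k) \<longlonglongrightarrow> 0"
    using \<open>M > 0\<close> \<open>0 < \<epsilon>\<close> by real_asymp
  then have "\<forall>\<^sub>F k in sequentially. (M * (real k + 1)) ^ d / (1 + \<epsilon>) ^ k < 1"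
    by (rule order_tendstoD) simp
  then obtain k where "(M * (real k + 1)) ^ d / (1 + \<epsilon>) ^ k < 1"
    by (auto simp: eventually_sequentially)
  with upper[of k] \<open>0 < \<epsilon>\<close> show False
    by (simp add: divide_less_eq split: if_splits)
qed

text \<open>By commutativity an element is determined by how often each generator or inverse occurs
  in it. So \<open>B n\<close> can be the image of the box of multiplicities at most
  \<open>n\<close>: adding multiplicities gives \<open>x + y \<in> B (m + n)\<close>, and counting
  the box gives the polynomial bound.\<close>

lemma finitely_generated_filtration:
  assumes "finitely_generated TYPE('g::ab_group_add)"
  obtains B :: "nat \<Rightarrow> 'g::ab_group_add set" and d :: nat
  where "incseq B" "\<And>n. finite (B n)" "\<And>n. 0 \<in> B n" "(\<Union>n. B n) = UNIV"
    "\<And>m n x y. x \<in> B m \<Longrightarrow> y \<in> B n \<Longrightarrow> x + y \<in> B (m + n)"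
    "\<And>n. card (B n) \<le> (n + 1) ^ d"
proof -
  obtain S :: "'g set" where S: "finite S" "group_closure S = UNIV"
    using assms by (auto simp: finitely_generated_def)
  define T where "T = S \<union> uminus ` S"
  have T: "finite T" using S by (simp add: T_def)
  \<comment> \<open>The inner sum is the \<open>k t\<close>-fold multiple of \<open>t\<close>,
    written as repeated addition.\<close>
  define comb where "comb k = (\<Sum>t\<in>T. \<Sum>i<k t. t)" for k :: "'g \<Rightarrow> nat"
  define B where "B n = comb ` (T \<rightarrow>\<^sub>E {..n})" for n
  have BI: "comb k \<in> B n" if "\<And>t. t \<in> T \<Longrightarrow> k t \<le> n" for k n
  proof -
    have "comb k = comb (restrict k T)" by (simp add: comb_def)
    moreover have "restrict k T \<in> T \<rightarrow>\<^sub>E {..n}" using that by auto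
    ultimately show ?thesis by (auto simp: B_def)
  qed
  have BE: "\<exists>k. (\<forall>t\<in>T. k t \<le> n) \<and> x = comb k" if x: "x \<in> B n" for x n
  proof -
    obtain k where "k \<in> T \<rightarrow>\<^sub>E {..n}" "x = comb k"
      using x by (auto simp: B_def)
    then show ?thesis by (intro exI[of _ k]) (auto dest: PiE_mem)
  qed
  have split: "(\<Sum>i<a + b. t) = (\<Sum>i<a. t) + (\<Sum>i<b. t)" for a b :: nat and t :: 'g
    by (induction a) (simp_all add: algebra_simps)
  have add: "x + y \<in> B (m + n)" if x: "x \<in> B m" and y: "y \<in> B n" for x y m n
  proof -
    obtain k l where "\<forall>t\<in>T. k t \<le> m" "x = comb k" "\<forall>t\<in>T. l t \<le> n" "y = comb l"
      using BE[OF x] BE[OF y] by blast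
    moreover have "comb (\<lambda>t. k t + l t) = comb k + comb l"
      by (simp add: comb_def split sum.distrib)
    ultimately show ?thesis
      using BI[of "\<lambda>t. k t + l t" "m + n"] by (auto intro: add_mono)
  qed
  have zero: "0 \<in> B n" for n
    using BI[of "\<lambda>_. 0" n] by (simp add: comb_def)
  \<comment> \<open>Negation permutes the symmetric set \<open>T\<close>, so it only permutes the
    multiplicities and keeps the bound \<open>n\<close>.\<close>
  have neg: "- x \<in> B n" if x: "x \<in> B n" for x n
  proof -
    obtain k where k: "\<forall>t\<in>T. k t \<le> n" "x = comb k"
      using BE[OF x] by blast
    have T_neg: "- t \<in> T" if "t \<in> T" for t
      using that by (auto simp: T_def)
    have "- comb k = (\<Sum>t\<in>T. \<Sum>i<k t. - t)"
      by (simp add: comb_def sum_negf)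
    also have "\<dots> = comb (\<lambda>t. k (- t))"
      unfolding comb_def by (rule sum.reindex_bij_witness[of _ uminus uminus]) (auto intro: T_neg)
    finally show ?thesis
      using BI[of "\<lambda>t. k (- t)" n] k T_neg by auto
  qed
  have gen: "t \<in> B 1" if "t \<in> T" for t
  proof -
    have "comb (\<lambda>s. if s = t then 1 else 0) = (\<Sum>s\<in>T. if s = t then t else 0)"
      unfolding comb_def by (rule sum.cong) auto
    also have "\<dots> = t" using T that by simp
    finally show ?thesis using BI[of "\<lambda>s. if s = t then 1 else 0" 1] by auto
  qed
  have cover: "x \<in> (\<Union>n. B n)" if "x \<in> group_closure S" for x
    using that
  proof induction
    case (base s)
    then show ?case using zero gen by (auto simp: T_def)
  next
    case (diff s t)
    then show ?case using add neg by (metis UN_iff UNIV_I diff_conv_add_uminus)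
  qed
  show ?thesis
  proof (rule that[of B "card T"])
    show "incseq B"
      unfolding B_def incseq_def by (auto intro!: image_mono PiE_mono)
    show "finite (B n)" for n
      using T by (auto simp: B_def intro!: finite_PiE)
    show "card (B n) \<le> (n + 1) ^ card T" for n
    proof -
      have "card (B n) \<le> card (T \<rightarrow>\<^sub>E {..n})"
        unfolding B_def using T by (intro card_image_le finite_PiE) auto
      then show ?thesis using T by (simp add: card_PiE)
    qed
    show "(\<Union>n. B n) = UNIV"
      using cover S(2) by auto
  qed (rule zero add; assumption?)+
qed

text \<open>A diagonal choice of radii: the \<open>n\<close>-th radius \<open>f n\<close> is one at
  which even the enlargement by \<open>n\<close> is nearly free. A fixed translation moves points by
  a fixed radius, hence is eventually covered by that enlargement.\<close>

lemma bohr_bochner_exists: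
  assumes "finitely_generated TYPE('g::ab_group_add)"
  shows "\<exists>H :: nat \<Rightarrow> 'g::ab_group_add set. bohr_bochner H"
proof -
  obtain B :: "nat \<Rightarrow> 'g set" and d :: nat
    where B: "incseq B" "\<And>n. finite (B n)" "\<And>n. 0 \<in> B n" "(\<Union>n. B n) = UNIV"
      "\<And>m n x y. x \<in> B m \<Longrightarrow> y \<in> B n \<Longrightarrow> x + y \<in> B (m + n)"
      "\<And>n. card (B n) \<le> (n + 1) ^ d"
    by (rule finitely_generated_filtration[OF assms]) blast
  \<comment> \<open>Enlargement and tolerance share the index \<open>m\<close>, so one diagonal
    sequence serves all translations; \<open>Suc\<close> avoids division by zero at
    \<open>m = 0\<close>.\<close>
  define slow where "slow m n \<longleftrightarrow>
    real (card (B (n + m))) \<le> (1 + 1 / real (Suc m)) * real (card (B n))" for m n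
  have pos: "0 < card (B n)" for n
    using B(2,3) by (auto simp: card_gt_0_iff)
  have ex: "\<exists>n\<ge>N. slow m n" for m N
    unfolding slow_def
  proof (rule polynomial_growth_slow_step)
    show "1 \<le> real (card (B n))" for n
      using pos[of n] by linarith
    show "real (card (B n)) \<le> (real n + 1) ^ d" for n
      using of_nat_mono[OF B(6)[of n], where 'a = real] by (simp add: add.commute)
  qed simp
  \<comment> \<open>The three conditions serve three purposes: \<open>n \<le> f n\<close> makes the
    sets exhaust the group, \<open>slow\<close> controls the boundary, and monotonicity of
    \<open>f\<close> makes the sets increase.\<close>
  have "\<exists>f. \<forall>n. (n \<le> f n \<and> slow n (f n)) \<and> f n \<le> f (Suc n)"
  proof (rule dependent_nat_choice)
    show "\<exists>x. 0 \<le> x \<and> slow 0 x"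
      using ex[of 0 0] by blast
    show "\<exists>y. (Suc n \<le> y \<and> slow (Suc n) y) \<and> x \<le> y" for x n
      using ex[of "max x (Suc n)" "Suc n"] by auto
  qed
  then obtain f where f: "\<And>n. n \<le> f n" "\<And>n. slow n (f n)" "\<And>n. f n \<le> f (Suc n)"
    by blast
  have "incseq (\<lambda>n. B (f n))"
    using B(1) f(3) by (intro incseq_SucI) (auto simp: incseq_def)
  moreover have "(\<Union>n. B (f n)) = UNIV"
  proof -
    have "B n \<subseteq> B (f n)" for n
      using B(1) f(1) by (simp add: incseq_def)
    then have "(\<Union>n. B n) \<subseteq> (\<Union>n. B (f n))" by (intro UN_mono) auto
    then show ?thesis using B(4) by auto
  qed
  moreover have "(\<lambda>n. real (card ((\<lambda>x. \<gamma> + x) ` B (f n) - B (f n))) / real (card (B (f n)))) \<longlonglongrightarrow> 0"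
    for \<gamma>
  proof -
    obtain k where k: "\<gamma> \<in> B k" using B(4) by blast
    \<comment> \<open>From index \<open>k\<close> on, \<gamma> lies in \<open>B n\<close>, so the
      translate stays inside \<open>B (f n + n)\<close> and can leave \<open>B (f n)\<close> only
      through the thin shell between the two.\<close>
    have bound: "real (card ((\<lambda>x. \<gamma> + x) ` B (f n) - B (f n))) / real (card (B (f n)))
      \<le> 1 / real (Suc n)" if "k \<le> n" for n
    proof -
      have "\<gamma> \<in> B n" using k that B(1) by (auto simp: incseq_def)
      then have "(\<lambda>x. \<gamma> + x) ` B (f n) \<subseteq> B (f n + n)"
        using B(5)[of \<gamma> n _ "f n"] by (auto simp: add.commute[of "f n"])
      then have "card ((\<lambda>x. \<gamma> + x) ` B (f n) - B (f n)) \<le> card (B (f n + n) - B (f n))"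
        using B(2) by (intro card_mono) auto
      also have "real \<dots> = real (card (B (f n + n))) - real (card (B (f n)))"
        using B(1,2) by (subst card_Diff_subset)
          (auto simp: incseq_def of_nat_diff card_mono)
      also have "\<dots> \<le> 1 / real (Suc n) * real (card (B (f n)))"
        using f(2)[of n] by (simp add: slow_def algebra_simps)
      finally show ?thesis
        using pos[of "f n"] by (simp add: divide_le_eq)
    qed
    show ?thesis
    proof (rule real_tendsto_sandwich)
      show "(\<lambda>n. 0 :: real) \<longlonglongrightarrow> 0" by simp
      show "(\<lambda>n. 1 / real (Suc n)) \<longlonglongrightarrow> 0" by real_asymp
      show "\<forall>\<^sub>F n in sequentially.
        real (card ((\<lambda>x. \<gamma> + x) ` B (f n) - B (f n))) / real (card (B (f n))) \<le> 1 / real (Suc n)"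
        using bound by (auto simp: eventually_sequentially)
    qed simp
  qed
  ultimately have "bohr_bochner (\<lambda>n. B (f n))"
    using B(2,3) unfolding bohr_bochner_def by blast
  then show ?thesis by blast
qed

section \<open>Orthonormal systems and continuity of complex-linear maps\<close>

lemma cinner_sum_left: "cinner (sum f S) y = (\<Sum>s\<in>S. cinner (f s) y)"
  for y :: "'a::complex_inner_space"
proof -
  have "cinner 0 y + cinner 0 y = cinner 0 y" by (metis cinner_add_left add_0)
  then show ?thesis
    by (induction S rule: infinite_finite_induct) (simp_all add: cinner_add_left)
qed

text \<open>Gram-Schmidt, one vector at a time: \<open>p\<close> is the projection of
  \<open>b\<close> to the span of \<open>C\<close>. Either \<open>b = p\<close> and \<open>C\<close>
  already suffices, or the normalised remainder \<open>u\<close> is added.\<close>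

lemma orthonormal_spanning:
  fixes B :: "'a::complex_inner_space set"
  assumes "finite B"
  shows "\<exists>C. finite C \<and> (\<forall>c\<in>C. \<forall>d\<in>C. cinner c d = (if c = d then 1 else 0)) \<and>
    B \<subseteq> scaleC.span C"
  using assms
proof induction
  case empty
  show ?case by (intro exI[of _ "{}"]) simp
next
  case (insert b B)
  then obtain C where C: "finite C" "\<And>c d. c \<in> C \<Longrightarrow> d \<in> C \<Longrightarrow> cinner c d = (if c = d then 1 else 0)"
    "B \<subseteq> scaleC.span C" by blast
  define p where "p = (\<Sum>c\<in>C. cinner b c *\<^sub>C c)"
  have p_span: "p \<in> scaleC.span C"
    unfolding p_def by (intro scaleC.span_sum scaleC.span_scale scaleC.span_base)
  have p_inner: "cinner p c = cinner b c" if "c \<in> C" for c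
  proof -
    have "cinner p c = (\<Sum>d\<in>C. if d = c then cinner b c else 0)"
      unfolding p_def cinner_sum_left
      by (rule sum.cong) (auto simp: cinner_scaleC_left C(2) that)
    then show ?thesis using C(1) that by simp
  qed
  show ?case
  proof (cases "b = p")
    case True
    then show ?thesis using C p_span by (intro exI[of _ C]) auto
  next
    case False
    define r where "r = norm (b - p)"
    define u where "u = complex_of_real (1 / r) *\<^sub>C (b - p)"
    have "r > 0" using False by (simp add: r_def)
    have perp: "cinner u c = 0" if "c \<in> C" for c
    proof -
      have "cinner (b - p) c + cinner p c = cinner b c"
        by (simp add: cinner_add_left[symmetric])
      then show ?thesis by (simp add: u_def cinner_scaleC_left p_inner[OF that])
    qed
    have perp': "cinner c u = 0" if "c \<in> C" for c
      using perp[OF that] cinner_commute[of c u] by simp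
    have "norm u = 1"
      using \<open>r > 0\<close> by (simp add: u_def norm_scaleC r_def norm_divide)
    then have unit: "cinner u u = 1"
      using norm_sq_eq_cinner[of u] by simp
    have "b = p + complex_of_real r *\<^sub>C u"
      using \<open>r > 0\<close> by (simp add: u_def scaleC_scaleC flip: of_real_mult)
    also have "\<dots> \<in> scaleC.span (insert u C)"
      using p_span scaleC.span_mono[of C "insert u C"]
      by (intro scaleC.span_add scaleC.span_scale) (auto intro: scaleC.span_base)
    finally have "insert b B \<subseteq> scaleC.span (insert u C)"
      using C(3) scaleC.span_mono[of C "insert u C"] by auto
    moreover have "u \<notin> C" using perp[of u] unit by auto
    ultimately show ?thesis
      using C(1,2) perp perp' unit by (intro exI[of _ "insert u C"]) auto
  qed
qed

text \<open>Coordinates in an orthonormal spanning system are at most the norm of the vector. This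
  continuity lets limits of means pass through the edge maps and \<open>dtau\<close>.\<close>

lemma bounded_linear_clinear:
  fixes f :: "'a::fd_complex_hilbert \<Rightarrow> 'b::complex_inner_space"
  assumes "clinear f"
  shows "bounded_linear f"
proof -
  interpret f: Vector_Spaces.linear scaleC scaleC f by (rule assms)
  obtain B :: "'a set" where B: "finite B" "\<And>x. \<exists>r. x = (\<Sum>b\<in>B. r b *\<^sub>C b)"
    using finite_dimensional by blast
  obtain C where C: "finite C" "B \<subseteq> scaleC.span C"
    "\<And>c d. c \<in> C \<Longrightarrow> d \<in> C \<Longrightarrow> cinner c d = (if c = d then 1 else 0)"
    using orthonormal_spanning[OF B(1)] by blast
  have bound: "norm (f x) \<le> norm x * (\<Sum>c\<in>C. norm (f c))" for x
  proof -
    have "x \<in> scaleC.span B"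
      using B by (auto simp: scaleC.span_finite)
    then have "x \<in> scaleC.span C"
      using C(2) by (meson scaleC.span_minimal scaleC.subspace_span subsetD)
    then obtain r where r: "x = (\<Sum>c\<in>C. r c *\<^sub>C c)"
      using C(1) by (auto simp: scaleC.span_finite)
    have coord: "cinner x c = r c" if "c \<in> C" for c
    proof -
      have "cinner x c = (\<Sum>d\<in>C. if d = c then r d else 0)"
        unfolding r cinner_sum_left
        by (rule sum.cong) (auto simp: cinner_scaleC_left C(3) that)
      then show ?thesis using C(1) that by simp
    qed
    \<comment> \<open>Only the first argument of the inner product is expanded; what remains,
      \<open>cinner c x\<close>, is the conjugate of \<open>r c\<close>, so each term is a squared
      modulus.\<close>
    have "complex_of_real ((norm x)\<^sup>2) = (\<Sum>c\<in>C. r c * cinner c x)"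
      by (subst norm_sq_eq_cinner, subst (1) r) (simp add: cinner_sum_left cinner_scaleC_left)
    also have "\<dots> = (\<Sum>c\<in>C. complex_of_real ((cmod (r c))\<^sup>2))"
    proof (rule sum.cong)
      fix c assume "c \<in> C"
      then show "r c * cinner c x = complex_of_real ((cmod (r c))\<^sup>2)"
        using coord[of c] cinner_commute[of c x] by (simp only: complex_norm_square)
    qed simp
    finally have pythagoras: "(norm x)\<^sup>2 = (\<Sum>c\<in>C. (cmod (r c))\<^sup>2)"
      by (simp only: of_real_sum[symmetric] of_real_eq_iff)
    have coord_le: "cmod (r c) \<le> norm x" if "c \<in> C" for c
    proof -
      have "(cmod (r c))\<^sup>2 \<le> (norm x)\<^sup>2"
        unfolding pythagoras using C(1) that by (intro member_le_sum) auto
      then show ?thesis by (rule power2_le_imp_le) simp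
    qed
    have "norm (f x) = norm (\<Sum>c\<in>C. r c *\<^sub>C f c)"
      by (simp add: r f.sum f.scale)
    also have "\<dots> \<le> (\<Sum>c\<in>C. norm x * norm (f c))"
      by (intro sum_norm_le) (simp add: norm_scaleC coord_le mult_right_mono)
    finally show ?thesis by (simp add: sum_distrib_left)
  qed
  show ?thesis
  proof (rule bounded_linear_intro)
    show "f (r *\<^sub>R x) = r *\<^sub>R f x" for r x
      by (simp add: f.scale flip: scaleC_of_real)
    show "norm (f x) \<le> norm x * (\<Sum>c\<in>C. norm (f c))" for x
      by (rule bound)
  qed (simp add: f.add)
qed

lemma bounded_linear_scaleC_left: "bounded_linear (\<lambda>c. c *\<^sub>C a)"
  for a :: "'a::complex_inner_space"
proof (rule bounded_linear_intro)
  show "(r *\<^sub>R c) *\<^sub>C a = r *\<^sub>R (c *\<^sub>C a)" for r c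
    by (simp add: scaleR_conv_of_real scaleC_scaleC flip: scaleC_of_real)
  show "norm (c *\<^sub>C a) \<le> norm c * norm a" for c
    by (simp add: norm_scaleC)
qed (simp add: scaleC_add_left)

lemma bounded_linear_scaleC_right:
  "bounded_linear (\<lambda>x::'a::complex_inner_space. c *\<^sub>C x)"
proof (rule bounded_linear_intro)
  show "c *\<^sub>C r *\<^sub>R x = r *\<^sub>R c *\<^sub>C x" for r and x :: 'a
    by (simp add: scaleC_scaleC mult.commute flip: scaleC_of_real)
  show "norm (c *\<^sub>C x) \<le> norm x * cmod c" for x :: 'a
    by (simp add: norm_scaleC)
qed (simp add: scaleC_add_right)

section \<open>Characters and means along Bohr-Bochner sequences\<close>

lemma character_add: "\<xi> \<in> characters \<Longrightarrow> \<xi> (a + b) = \<xi> a * \<xi> b"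
  and character_norm: "\<xi> \<in> characters \<Longrightarrow> cmod (\<xi> a) = 1"
  by (simp_all add: characters_def)

lemma character_cnj_mult: "\<xi> \<in> characters \<Longrightarrow> cnj (\<xi> a) * \<xi> a = 1"
  using complex_norm_square[of "\<xi> a"] by (simp add: character_norm mult.commute)

text \<open>For empty or infinite \<open>A\<close> the value is 0, so the linearity rules and the
  norm bound below hold for every set.\<close>

definition set_mean :: "'a set \<Rightarrow> ('a \<Rightarrow> 'b) \<Rightarrow> 'b::real_normed_vector" where
  "set_mean A f = (1 / real (card A)) *\<^sub>R (\<Sum>x\<in>A. f x)"

lemma norm_set_mean_le:
  assumes "\<And>x. norm (f x) \<le> K" "0 \<le> K"
  shows "norm (set_mean A f) \<le> K"
proof -
  have "norm (\<Sum>x\<in>A. f x) \<le> real (card A) * K"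
    using assms(1) by (intro sum_norm_bound) auto
  then show ?thesis
    using assms(2) by (cases "card A = 0") (auto simp: set_mean_def divide_le_eq mult.commute)
qed

lemma set_mean_diff: "set_mean A (\<lambda>x. f x - g x) = set_mean A f - set_mean A g"
  by (simp add: set_mean_def sum_subtractf scaleR_diff_right)

lemma set_mean_sum: "set_mean A (\<lambda>x. \<Sum>k\<in>S. f k x) = (\<Sum>k\<in>S. set_mean A (f k))"
  unfolding set_mean_def by (subst sum.swap) (simp add: scaleR_sum_right)

lemma set_mean_bounded_linear:
  assumes "bounded_linear L"
  shows "set_mean A (\<lambda>x. L (f x)) = L (set_mean A f)"
proof -
  interpret bounded_linear L by (rule assms)
  show ?thesis by (simp add: set_mean_def scaleR sum)
qed

text \<open>The two sums differ only on the symmetric difference of \<open>H n\<close> and its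
  translate, whose relative size tends to 0. Hence limits of means are translation
  invariant.\<close>

lemma set_mean_translate:
  fixes H :: "nat \<Rightarrow> 'g::ab_group_add set" and f :: "'g \<Rightarrow> 'z::real_normed_vector"
  assumes "bohr_bochner H" "\<And>x. norm (f x) \<le> K"
  shows "(\<lambda>n. set_mean (H n) (\<lambda>x. f (\<gamma> + x)) - set_mean (H n) f) \<longlonglongrightarrow> 0"
proof -
  define r where "r n = real (card ((\<lambda>x. \<gamma> + x) ` H n - H n)) / real (card (H n))" for n
  have fin: "finite (H n)" for n
    using assms(1) by (simp add: bohr_bochner_def)
  have "norm (set_mean (H n) (\<lambda>x. f (\<gamma> + x)) - set_mean (H n) f) \<le> 2 * K * r n" for n
  proof -
    let ?A = "H n" and ?B = "(\<lambda>x. \<gamma> + x) ` H n"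
    have "card ?B = card ?A" by (simp add: card_image)
    \<comment> \<open>The Bohr-Bochner condition controls one of the two differences; the other has
      the same size, as both arise by removing the common intersection from sets of equal
      size.\<close>
    then have card: "card (?A - ?B) = card (?B - ?A)"
      using fin[of n] by (simp add: card_Diff_subset_Int Int_commute)
    have "(\<Sum>x\<in>?A. f (\<gamma> + x)) = sum f ?B"
      by (simp add: sum.reindex)
    also have "\<dots> - sum f ?A = sum f (?B - ?A) - sum f (?A - ?B)"
      using sum.Int_Diff[of ?B f ?A] sum.Int_Diff[of ?A f ?B] fin[of n]
      by (simp add: Int_commute)
    finally have "norm ((\<Sum>x\<in>?A. f (\<gamma> + x)) - sum f ?A) \<le>
        real (card (?B - ?A)) * K + real (card (?A - ?B)) * K"
      using sum_norm_bound[of "?B - ?A" f K] sum_norm_bound[of "?A - ?B" f K] assms(2)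
        norm_triangle_ineq4[of "sum f (?B - ?A)" "sum f (?A - ?B)"] by force
    then have "norm ((\<Sum>x\<in>?A. f (\<gamma> + x)) - sum f ?A) \<le> 2 * K * real (card (?B - ?A))"
      by (simp add: card)
    then have "1 / real (card ?A) * norm ((\<Sum>x\<in>?A. f (\<gamma> + x)) - sum f ?A)
        \<le> 1 / real (card ?A) * (2 * K * real (card (?B - ?A)))"
      by (intro mult_left_mono) auto
    then show ?thesis
      by (simp add: set_mean_def r_def flip: scaleR_diff_right)
  qed
  moreover have "r \<longlonglongrightarrow> 0"
    using assms(1) by (simp add: bohr_bochner_def r_def[abs_def])
  then have "(\<lambda>n. 2 * K * r n) \<longlonglongrightarrow> 0"
    by (rule tendsto_mult_right_zero)
  ultimately show ?thesis
    by (metis (no_types, lifting) Lim_null_comparison always_eventually)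
qed

text \<open>Translation by \<gamma> multiplies the mean by \<open>\<xi> \<gamma>\<close> but changes
  it only by a null sequence; if \<open>\<xi> \<gamma> \<noteq> 1\<close>, dividing by
  \<open>\<xi> \<gamma> - 1\<close> shows that the mean itself tends to 0.\<close>

lemma set_mean_character:
  assumes "bohr_bochner H" "\<xi> \<in> characters"
  shows "(\<lambda>n. set_mean (H n) \<xi>) \<longlonglongrightarrow> (if \<xi> = (\<lambda>_. 1) then 1 else 0)"
proof (cases "\<xi> = (\<lambda>_. 1)")
  case True
  have card: "card (H n) \<noteq> 0" for n
    using assms(1) by (simp add: bohr_bochner_def)
  with True show ?thesis by (simp add: set_mean_def scaleR_conv_of_real card)
next
  case False
  then obtain \<gamma> where \<gamma>: "\<xi> \<gamma> \<noteq> 1" by auto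
  have "set_mean (H n) (\<lambda>x. \<xi> (\<gamma> + x)) = \<xi> \<gamma> * set_mean (H n) \<xi>" for n
    unfolding character_add[OF assms(2)]
    by (rule set_mean_bounded_linear) (rule bounded_linear_mult_right)
  then have "(\<lambda>n. \<xi> \<gamma> * set_mean (H n) \<xi> - set_mean (H n) \<xi>) \<longlonglongrightarrow> 0"
    using set_mean_translate[OF assms(1), of \<xi> 1 \<gamma>] by (simp add: character_norm[OF assms(2)])
  then have "(\<lambda>n. (\<xi> \<gamma> * set_mean (H n) \<xi> - set_mean (H n) \<xi>) / (\<xi> \<gamma> - 1)) \<longlonglongrightarrow> 0 / (\<xi> \<gamma> - 1)"
    using \<gamma> by (intro tendsto_divide tendsto_const) auto
  moreover have "(\<xi> \<gamma> * set_mean (H n) \<xi> - set_mean (H n) \<xi>) / (\<xi> \<gamma> - 1) = set_mean (H n) \<xi>" for n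
    using \<gamma> by (simp add: field_simps)
  ultimately show ?thesis using False by simp
qed

section \<open>Existence and uniqueness of Fourier coefficients\<close>

text \<open>The property under the \<open>THE\<close> of \<open>fourier_coeff\<close>, separated so
  that existence can be proved first. Without any Bohr-Bochner sequence every \<open>c\<close> would
  satisfy it, so uniqueness rests on \<open>bohr_bochner_exists\<close>.\<close>

definition has_fourier_coeff ::
  "('g::ab_group_add \<Rightarrow> 'z::complex_inner_space) \<Rightarrow> ('g \<Rightarrow> complex) \<Rightarrow> 'z \<Rightarrow> bool" where
  "has_fourier_coeff h \<xi> c \<longleftrightarrow>
     (\<forall>H. bohr_bochner H \<longrightarrow> (\<lambda>n. set_mean (H n) (\<lambda>\<gamma>. cnj (\<xi> \<gamma>) *\<^sub>C h \<gamma>)) \<longlonglongrightarrow> c)"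

text \<open>Orthogonality of characters: the averaged function is
  \<open>\<theta> \<gamma> *\<^sub>C a\<close> for the character \<open>\<theta>\<close>, the
  product of the conjugate of \<xi> with \<eta>, which is trivial exactly when the two
  agree.\<close>

lemma has_fourier_coeff_character:
  assumes "\<xi> \<in> characters" "\<eta> \<in> characters"
  shows "has_fourier_coeff (\<lambda>\<gamma>. \<eta> \<gamma> *\<^sub>C a) \<xi> (if \<eta> = \<xi> then a else 0)"
  unfolding has_fourier_coeff_def
proof (intro allI impI)
  fix H :: "nat \<Rightarrow> 'a set"
  assume H: "bohr_bochner H"
  define \<theta> where "\<theta> = (\<lambda>\<gamma>. cnj (\<xi> \<gamma>) * \<eta> \<gamma>)"
  have \<theta>: "\<theta> \<in> characters"
    using assms by (simp add: characters_def \<theta>_def norm_mult)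
  have iff: "\<theta> = (\<lambda>_. 1) \<longleftrightarrow> \<eta> = \<xi>"
  proof
    assume "\<theta> = (\<lambda>_. 1)"
    then have "cnj (\<xi> \<gamma>) * \<eta> \<gamma> = cnj (\<xi> \<gamma>) * \<xi> \<gamma>" for \<gamma>
      using character_cnj_mult[OF assms(1), of \<gamma>] by (metis \<theta>_def)
    moreover have "cnj (\<xi> \<gamma>) \<noteq> 0" for \<gamma>
      using character_norm[OF assms(1), of \<gamma>] by auto
    ultimately show "\<eta> = \<xi>" by auto
  qed (simp add: \<theta>_def character_cnj_mult[OF assms(1)])
  have "(\<lambda>n. set_mean (H n) \<theta> *\<^sub>C a) \<longlonglongrightarrow> (if \<theta> = (\<lambda>_. 1) then 1 else 0) *\<^sub>C a"
    by (intro bounded_linear.tendsto[OF bounded_linear_scaleC_left] set_mean_character H \<theta>)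
  moreover have "set_mean (H n) \<theta> *\<^sub>C a = set_mean (H n) (\<lambda>\<gamma>. cnj (\<xi> \<gamma>) *\<^sub>C \<eta> \<gamma> *\<^sub>C a)" for n
    by (simp add: scaleC_scaleC \<theta>_def set_mean_bounded_linear[OF bounded_linear_scaleC_left])
  ultimately show "(\<lambda>n. set_mean (H n) (\<lambda>\<gamma>. cnj (\<xi> \<gamma>) *\<^sub>C \<eta> \<gamma> *\<^sub>C a)) \<longlonglongrightarrow> (if \<eta> = \<xi> then a else 0)"
    by (simp add: iff cong: if_cong split: if_splits)
qed

lemma has_fourier_coeff_trig_poly:
  assumes "p \<in> trig_polys" "\<xi> \<in> characters"
  shows "\<exists>c. has_fourier_coeff (apply_bcontfun p) \<xi> c"
proof -
  obtain n :: nat and \<eta> a where p: "\<And>k. k \<in> {1..n} \<Longrightarrow> \<eta> k \<in> characters"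
    "\<And>\<gamma>. p \<gamma> = (\<Sum>k=1..n. \<eta> k \<gamma> *\<^sub>C a k)"
    using assms(1) unfolding trig_polys_def by blast
  \<comment> \<open>The characters \<open>\<eta> k\<close> may repeat, so all terms with
    \<open>\<eta> k = \<xi>\<close> contribute.\<close>
  have "has_fourier_coeff p \<xi> (\<Sum>k=1..n. if \<eta> k = \<xi> then a k else 0)"
    unfolding has_fourier_coeff_def p(2) scaleC.scale_sum_right set_mean_sum
    using has_fourier_coeff_character[OF assms(2) p(1), unfolded has_fourier_coeff_def]
    by (intro allI impI tendsto_sum) blast
  then show ?thesis by blast
qed

text \<open>Since the bound does not depend on \<open>A\<close>, the limit along the sets can be
  interchanged with uniform approximation by trigonometric polynomials.\<close>

lemma norm_set_mean_cnj_scaleC_diff_le: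
  fixes p q :: "'g::{ab_group_add,discrete_topology} \<Rightarrow>\<^sub>C 'z::fd_complex_hilbert"
  assumes "\<xi> \<in> characters"
  shows "norm (set_mean A (\<lambda>\<gamma>. cnj (\<xi> \<gamma>) *\<^sub>C p \<gamma>) - set_mean A (\<lambda>\<gamma>. cnj (\<xi> \<gamma>) *\<^sub>C q \<gamma>)) \<le> dist p q"
proof -
  have "norm (cnj (\<xi> \<gamma>) *\<^sub>C p \<gamma> - cnj (\<xi> \<gamma>) *\<^sub>C q \<gamma>) \<le> dist p q" for \<gamma>
    using dist_bounded[of p \<gamma> q]
    by (simp add: scaleC.scale_right_diff_distrib[symmetric] norm_scaleC character_norm[OF assms] dist_norm)
  then show ?thesis
    unfolding set_mean_diff[symmetric] by (intro norm_set_mean_le) auto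
qed

text \<open>The coefficients of approximating trigonometric polynomials form a Cauchy sequence, and
  by the uniform mean estimate its limit is the coefficient of \<open>h\<close>.\<close>

lemma AP_has_fourier_coeff:
  fixes h :: "'g::{ab_group_add,discrete_topology} \<Rightarrow>\<^sub>C 'z::fd_complex_hilbert"
  assumes fg: "finitely_generated TYPE('g)" and "h \<in> AP" and \<xi>: "\<xi> \<in> characters"
  shows "\<exists>c. has_fourier_coeff h \<xi> c"
proof -
  define M where "M A p = set_mean A (\<lambda>\<gamma>. cnj (\<xi> \<gamma>) *\<^sub>C apply_bcontfun p \<gamma>)"
    for A and p :: "'g \<Rightarrow>\<^sub>C 'z"
  have M_le: "norm (M A p - M A q) \<le> dist p q" for A p q
    unfolding M_def by (rule norm_set_mean_cnj_scaleC_diff_le[OF \<xi>])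
  obtain p where p: "\<And>k. p k \<in> trig_polys" "p \<longlonglongrightarrow> h"
    using assms(2) by (auto simp: AP_def closure_sequential)
  have "\<exists>c. has_fourier_coeff (apply_bcontfun (p k)) \<xi> c" for k
    by (rule has_fourier_coeff_trig_poly[OF p(1) \<xi>])
  then obtain c where c: "\<And>k. has_fourier_coeff (apply_bcontfun (p k)) \<xi> (c k)"
    by metis
  have lim: "(\<lambda>n. M (H n) (p k)) \<longlonglongrightarrow> c k" if "bohr_bochner H" for H k
    using c[of k] that by (simp add: has_fourier_coeff_def M_def)
  \<comment> \<open>Each \<open>c k\<close> is the limit along every Bohr-Bochner sequence, so a
    single one suffices to compare \<open>c k\<close> with \<open>c l\<close>, and the resulting
    \<open>c'\<close> depends on no choice of sequence.\<close>
  obtain H\<^sub>0 :: "nat \<Rightarrow> 'g set" where H\<^sub>0: "bohr_bochner H\<^sub>0"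
    using bohr_bochner_exists[OF fg] by blast
  have c_le: "dist (c k) (c l) \<le> dist (p k) (p l)" for k l
  proof -
    have "(\<lambda>n. M (H\<^sub>0 n) (p k) - M (H\<^sub>0 n) (p l)) \<longlonglongrightarrow> c k - c l"
      by (intro tendsto_diff lim H\<^sub>0)
    then have "norm (c k - c l) \<le> dist (p k) (p l)"
      by (rule Lim_norm_ubound[rotated]) (auto simp: M_le)
    then show ?thesis by (simp add: dist_norm)
  qed
  have "Cauchy p" using p(2) by (rule LIMSEQ_imp_Cauchy)
  then have "Cauchy c"
    unfolding Cauchy_def using c_le by (meson le_less_trans)
  then obtain c' where c': "c \<longlonglongrightarrow> c'"
    by (auto simp: Cauchy_convergent_iff convergent_def)
  \<comment> \<open>The three thirds are the error of replacing \<open>h\<close> by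
    \<open>p k\<close>, the distance of the mean of \<open>p k\<close> from \<open>c k\<close>, and
    that of \<open>c k\<close> from \<open>c'\<close>.\<close>
  have "(\<lambda>n. M (H n) h) \<longlonglongrightarrow> c'" if H: "bohr_bochner H" for H
  proof (rule tendstoI)
    fix \<epsilon> :: real assume "0 < \<epsilon>"
    then have "0 < \<epsilon> / 3" by simp
    have "\<forall>\<^sub>F k in sequentially. dist (p k) h < \<epsilon> / 3 \<and> dist (c k) c' < \<epsilon> / 3"
      using tendstoD[OF p(2) \<open>0 < \<epsilon> / 3\<close>] tendstoD[OF c' \<open>0 < \<epsilon> / 3\<close>] by (rule eventually_conj)
    then obtain k where k: "dist (p k) h < \<epsilon> / 3" "dist (c k) c' < \<epsilon> / 3"
      by (auto simp: eventually_sequentially)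
    show "\<forall>\<^sub>F n in sequentially. dist (M (H n) h) c' < \<epsilon>"
      using tendstoD[OF lim[OF H, of k] \<open>0 < \<epsilon> / 3\<close>]
    proof eventually_elim
      case (elim n)
      have "dist (M (H n) h) (M (H n) (p k)) < \<epsilon> / 3"
        using M_le[of "H n" h "p k"] k(1) by (simp only: dist_norm[of "M _ _"] dist_commute[of "p k" h])
      then show ?case
        using elim k(2) dist_triangle[of "M (H n) h" c' "M (H n) (p k)"]
          dist_triangle[of "M (H n) (p k)" c' "c k"] by linarith
    qed
  qed
  then show ?thesis
    by (auto simp: has_fourier_coeff_def M_def)
qed

lemma fourier_coeff_eqI:
  fixes h :: "'g::{ab_group_add,discrete_topology} \<Rightarrow>\<^sub>C 'z::fd_complex_hilbert"
  assumes "finitely_generated TYPE('g)" "has_fourier_coeff h \<xi> c"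
  shows "fourier_coeff h \<xi> = c"
proof -
  obtain H :: "nat \<Rightarrow> 'g set" where "bohr_bochner H"
    using bohr_bochner_exists[OF assms(1)] by blast
  then have "c' = c" if "has_fourier_coeff h \<xi> c'" for c'
    using assms(2) that by (auto simp: has_fourier_coeff_def intro: LIMSEQ_unique)
  then have "(THE c. has_fourier_coeff h \<xi> c) = c"
    using assms(2) by (rule the_equality[rotated])
  then show ?thesis
    by (simp add: fourier_coeff_def has_fourier_coeff_def set_mean_def)
qed

section \<open>Flexes in untwisted form\<close>

text \<open>\<open>Bcontfun\<close> evaluates as expected once its argument is bounded. Here each
  component is bounded uniformly in \<gamma>, because \<open>dtau\<close> is isometric and the edge
  maps are continuous.\<close>

lemma gain_framework_operator_apply:
  assumes "is_gain_framework G"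
  shows "gain_framework_operator G f \<gamma> = (\<chi> e. if e \<in> arcs (graph G)
    then edge_map G e (dtau G (- \<gamma>) (f \<gamma> $ source G e - f (\<gamma> + gain G e) $ target G e))
    else 0)"
proof -
  define F where "F \<gamma> = (\<chi> e. if e \<in> arcs (graph G)
    then edge_map G e (dtau G (- \<gamma>) (f \<gamma> $ source G e - f (\<gamma> + gain G e) $ target G e))
    else 0)" for \<gamma>
  define K where "K e = (if e \<in> arcs (graph G) then onorm (edge_map G e) * (2 * norm f) else 0)" for e
  have "norm (F \<gamma> $ e) \<le> K e" for \<gamma> e
  proof (cases "e \<in> arcs (graph G)")
    case True
    then have bl: "bounded_linear (edge_map G e)"
      using assms by (intro bounded_linear_clinear) (simp add: is_gain_framework_def)
    have comp: "norm (f \<beta> $ v) \<le> norm f" for \<beta> v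
      using Finite_Cartesian_Product.norm_nth_le[of "f \<beta>" v] norm_bounded[of f \<beta>] by (rule order_trans)
    have "norm (dtau G (- \<gamma>) (f \<gamma> $ source G e - f (\<gamma> + gain G e) $ target G e)) \<le> 2 * norm f"
      unfolding dtau_Isom(2)[OF assms]
      using norm_triangle_ineq4[of "f \<gamma> $ source G e" "f (\<gamma> + gain G e) $ target G e"]
        comp[of \<gamma> "source G e"] comp[of "\<gamma> + gain G e" "target G e"] by linarith
    then have "norm (edge_map G e (dtau G (- \<gamma>) (f \<gamma> $ source G e - f (\<gamma> + gain G e) $ target G e)))
        \<le> onorm (edge_map G e) * (2 * norm f)"
      by (intro order_trans[OF onorm[OF bl]] mult_left_mono onorm_pos_le[OF bl])
    then show ?thesis using True by (simp add: F_def K_def)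
  qed (simp add: F_def K_def)
  then have "norm (F \<gamma>) \<le> sum K UNIV" for \<gamma>
    unfolding norm_vec_def by (intro order_trans[OF L2_set_le_sum] sum_mono) auto
  then have "apply_bcontfun (Bcontfun F) = F"
    by (rule apply_Bcontfun_le)
  then show ?thesis
    by (simp add: gain_framework_operator_def F_def[abs_def])
qed

text \<open>The factor \<open>dtau G (- \<gamma>)\<close> cancels the twist at \<gamma> and leaves
  \<open>dtau G m\<close> at \<open>\<gamma> + m\<close>, so the coefficients of the equation no
  longer depend on \<gamma>.\<close>

lemma twist_flex_iff:
  assumes "is_gain_framework G"
  shows "twist G h \<in> bounded_inf_flexes G \<longleftrightarrow> (\<forall>\<gamma>. \<forall>e\<in>arcs (graph G).
    edge_map G e (h \<gamma> $ source G e - dtau G (gain G e) (h (\<gamma> + gain G e) $ target G e)) = 0)"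
proof -
  have "dtau G (- \<gamma>) (dtau G \<gamma> x - dtau G (\<gamma> + m) y) = x - dtau G m y" for \<gamma> m x y
  proof -
    interpret A: Vector_Spaces.linear scaleC scaleC "dtau G (- \<gamma>)"
      by (rule dtau_Isom(1)[OF assms])
    show ?thesis
      by (simp add: A.diff dtau_add[OF assms, symmetric] dtau_zero[OF assms])
  qed
  then have op: "gain_framework_operator G (twist G h) \<gamma> = (\<chi> e. if e \<in> arcs (graph G)
      then edge_map G e (h \<gamma> $ source G e - dtau G (gain G e) (h (\<gamma> + gain G e) $ target G e))
      else 0)" for \<gamma>
    by (simp add: gain_framework_operator_apply[OF assms] twist_apply[OF assms] cong: if_cong)
  have "gain_framework_operator G (twist G h) = 0 \<longleftrightarrow>
      (\<forall>\<gamma>. gain_framework_operator G (twist G h) \<gamma> = 0)"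
    by (auto intro: bcontfun_eqI)
  then show ?thesis
    unfolding bounded_inf_flexes_def mem_Collect_eq op by (auto simp: vec_eq_iff)
qed

section \<open>Kernel of the orbit matrix: Fourier coefficients and symmetric vectors\<close>

lemma orbit_matrix_eq_0_iff:
  "orbit_matrix G \<xi> a = 0 \<longleftrightarrow> (\<forall>e\<in>arcs (graph G).
    edge_map G e (a $ source G e - \<xi> (gain G e) *\<^sub>C dtau G (gain G e) (a $ target G e)) = 0)"
  by (auto simp: orbit_matrix_def vec_eq_iff)

lemma orbit_matrix_fourier_coeff:
  assumes fg: "finitely_generated TYPE('g::{ab_group_add,discrete_topology})"
    and G: "is_gain_framework (G :: ('v::finite, 'e::finite, 'g::{ab_group_add,discrete_topology},
      'x::fd_complex_hilbert, 'y::fd_complex_hilbert) gain_framework)"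
    and flex: "twist G h \<in> bounded_inf_flexes G"
    and c: "has_fourier_coeff h \<xi> c" and \<xi>: "\<xi> \<in> characters"
  shows "orbit_matrix G \<xi> c = 0"
  unfolding orbit_matrix_eq_0_iff
proof
  fix e assume e: "e \<in> arcs (graph G)"
  define m where "m = gain G e"
  interpret \<phi>: Vector_Spaces.linear scaleC scaleC "edge_map G e"
    using G e by (simp add: is_gain_framework_def)
  interpret D: Vector_Spaces.linear scaleC scaleC "dtau G m"
    by (rule dtau_Isom(1)[OF G])
  have bl_\<phi>: "bounded_linear (edge_map G e)"
    by (rule bounded_linear_clinear) (rule \<phi>.linear_axioms)
  have bl_D: "bounded_linear (dtau G m)"
    by (rule bounded_linear_clinear) (rule D.linear_axioms)
  \<comment> \<open>\<open>P\<close> and \<open>Q\<close> are the two terms in row \<open>e\<close>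
    of the orbit matrix, so the goal becomes \<open>P c = Q c\<close>.\<close>
  define P where "P a = edge_map G e (a $ source G e)" for a :: "'x ^ 'v"
  define Q where "Q a = edge_map G e (\<xi> m *\<^sub>C dtau G m (a $ target G e))" for a :: "'x ^ 'v"
  have P: "bounded_linear P"
    unfolding P_def by (rule bounded_linear_compose[OF bl_\<phi> bounded_linear_vec_nth])
  have Q: "bounded_linear Q"
    unfolding Q_def
    by (rule bounded_linear_compose[OF bl_\<phi>], rule bounded_linear_compose[OF bounded_linear_scaleC_right],
        rule bounded_linear_compose[OF bl_D], rule bounded_linear_vec_nth)
  define u where "u \<gamma> = cnj (\<xi> \<gamma>) *\<^sub>C h \<gamma>" for \<gamma>
  \<comment> \<open>This is the flex equation times the conjugate of \<open>\<xi> \<gamma>\<close>;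
    the factor \<open>\<xi> m\<close> in \<open>Q\<close> absorbs the phase that the shift of
    \<open>u\<close> by \<open>m\<close> produces.\<close>
  have PQ: "P (u \<gamma>) = Q (u (m + \<gamma>))" for \<gamma>
  proof -
    have "\<xi> m * cnj (\<xi> (m + \<gamma>)) = cnj (\<xi> \<gamma>)"
    proof -
      have "\<xi> m * cnj (\<xi> (m + \<gamma>)) = cnj (\<xi> m) * \<xi> m * cnj (\<xi> \<gamma>)"
        by (simp add: character_add[OF \<xi>])
      then show ?thesis by (simp add: character_cnj_mult[OF \<xi>])
    qed
    then have "Q (u (m + \<gamma>)) = cnj (\<xi> \<gamma>) *\<^sub>C edge_map G e (dtau G m (h (m + \<gamma>) $ target G e))"
      by (simp add: Q_def u_def scaleC_vec_def D.scale \<phi>.scale)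
    moreover have "P (u \<gamma>) = cnj (\<xi> \<gamma>) *\<^sub>C edge_map G e (h \<gamma> $ source G e)"
      by (simp add: P_def u_def scaleC_vec_def \<phi>.scale)
    moreover have "edge_map G e (h \<gamma> $ source G e - dtau G m (h (\<gamma> + m) $ target G e)) = 0"
      using flex e unfolding twist_flex_iff[OF G] m_def by blast
    then have "edge_map G e (h \<gamma> $ source G e) = edge_map G e (dtau G m (h (m + \<gamma>) $ target G e))"
      by (simp add: \<phi>.diff add.commute[of m])
    ultimately show ?thesis by simp
  qed
  obtain H :: "nat \<Rightarrow> 'g set" where H: "bohr_bochner H"
    using bohr_bochner_exists[OF fg] by blast
  have mean: "(\<lambda>n. set_mean (H n) u) \<longlonglongrightarrow> c"
    using c H by (simp add: has_fourier_coeff_def u_def[abs_def])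
  have "norm (u \<gamma>) \<le> norm h" for \<gamma>
    by (simp add: u_def norm_scaleC character_norm[OF \<xi>] norm_bounded)
  then have "(\<lambda>n. set_mean (H n) (\<lambda>\<gamma>. u (m + \<gamma>)) - set_mean (H n) u) \<longlonglongrightarrow> 0"
    by (rule set_mean_translate[OF H])
  \<comment> \<open>By translation invariance the shifted means also tend to \<open>c\<close>; thus
    both sides of \<open>PQ\<close>, averaged, converge to \<open>P c\<close> and
    \<open>Q c\<close>.\<close>
  from tendsto_add[OF this mean] have "(\<lambda>n. set_mean (H n) (\<lambda>\<gamma>. u (m + \<gamma>))) \<longlonglongrightarrow> c"
    by simp
  then have "(\<lambda>n. Q (set_mean (H n) (\<lambda>\<gamma>. u (m + \<gamma>)))) \<longlonglongrightarrow> Q c"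
    by (rule bounded_linear.tendsto[OF Q])
  moreover have "(\<lambda>n. P (set_mean (H n) u)) \<longlonglongrightarrow> P c"
    using mean by (rule bounded_linear.tendsto[OF P])
  ultimately have "P c = Q c"
    unfolding set_mean_bounded_linear[OF P, symmetric] set_mean_bounded_linear[OF Q, symmetric] PQ
    by (rule LIMSEQ_unique[rotated])
  then show "edge_map G e (c $ source G e - \<xi> (gain G e) *\<^sub>C dtau G (gain G e) (c $ target G e)) = 0"
    by (simp add: P_def Q_def m_def \<phi>.diff)
qed

lemma character_scaleC_bcontfun:
  fixes a :: "'z::fd_complex_hilbert"
  assumes "\<xi> \<in> characters"
  shows "apply_bcontfun (Bcontfun (\<lambda>\<gamma>::'g::{ab_group_add,discrete_topology}. \<xi> \<gamma> *\<^sub>C a)) = (\<lambda>\<gamma>. \<xi> \<gamma> *\<^sub>C a)"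
  by (rule apply_Bcontfun_le[of _ "norm a"]) (simp add: norm_scaleC character_norm[OF assms])

text \<open>Makes the criterion \<open>twist_flex_iff\<close> applicable to symmetric vectors, with
  a single-character function as the untwisted form.\<close>

lemma symmetric_vector_eq_twist:
  assumes "is_gain_framework G" "\<xi> \<in> characters"
  shows "symmetric_vector G \<xi> a = twist G (Bcontfun (\<lambda>\<gamma>. \<xi> \<gamma> *\<^sub>C a))"
proof (rule bcontfun_eqI)
  fix \<gamma>
  interpret D: Vector_Spaces.linear scaleC scaleC "dtau G \<gamma>"
    by (rule dtau_Isom(1)[OF assms(1)])
  show "symmetric_vector G \<xi> a \<gamma> = twist G (Bcontfun (\<lambda>\<gamma>. \<xi> \<gamma> *\<^sub>C a)) \<gamma>"
    by (simp add: symmetric_vector_apply[OF assms] twist_apply[OF assms(1)]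
        character_scaleC_bcontfun[OF assms(2)] D.scale)
      (simp add: scaleC_vec_def D.scale)
qed

text \<open>The nonzero factor \<open>\<xi> \<gamma>\<close> comes out of the flex equation at
  \<gamma>, so the equations at all group elements are equivalent to the single orbit
  equation.\<close>

lemma symmetric_vector_flex_iff:
  assumes G: "is_gain_framework G" and \<xi>: "\<xi> \<in> characters"
  shows "symmetric_vector G \<xi> a \<in> bounded_inf_flexes G \<longleftrightarrow> orbit_matrix G \<xi> a = 0"
proof -
  have "edge_map G e ((\<xi> \<gamma> *\<^sub>C a) $ source G e - dtau G (gain G e) ((\<xi> (\<gamma> + gain G e) *\<^sub>C a) $ target G e)) = 0
    \<longleftrightarrow> edge_map G e (a $ source G e - \<xi> (gain G e) *\<^sub>C dtau G (gain G e) (a $ target G e)) = 0"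
    if e: "e \<in> arcs (graph G)" for e \<gamma>
  proof -
    interpret \<phi>: Vector_Spaces.linear scaleC scaleC "edge_map G e"
      using G e by (simp add: is_gain_framework_def)
    interpret D: Vector_Spaces.linear scaleC scaleC "dtau G (gain G e)"
      by (rule dtau_Isom(1)[OF G])
    have "(\<xi> \<gamma> *\<^sub>C a) $ source G e - dtau G (gain G e) ((\<xi> (\<gamma> + gain G e) *\<^sub>C a) $ target G e)
      = \<xi> \<gamma> *\<^sub>C (a $ source G e - \<xi> (gain G e) *\<^sub>C dtau G (gain G e) (a $ target G e))"
      by (simp add: scaleC_vec_def D.scale character_add[OF \<xi>] scaleC.scale_right_diff_distrib)
    moreover have "\<xi> \<gamma> \<noteq> 0" using character_norm[OF \<xi>, of \<gamma>] by auto
    ultimately show ?thesis by (simp add: \<phi>.scale)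
  qed
  then show ?thesis
    by (simp add: symmetric_vector_eq_twist[OF G \<xi>] twist_flex_iff[OF G]
        character_scaleC_bcontfun[OF \<xi>] orbit_matrix_eq_0_iff)
qed

theorem theorem4p8:
  fixes G\<^sub>0 :: "('v::finite, 'e::finite, 'g::{ab_group_add,discrete_topology},
                 'x::fd_complex_hilbert, 'y::fd_complex_hilbert) gain_framework"
  assumes "finitely_generated TYPE('g)"
    and "is_gain_framework G\<^sub>0"
  shows "rum_spectrum G\<^sub>0 =
           (\<Union>g\<in>twisted_ap_flexes G\<^sub>0. bohr_fourier_spectrum (inv (twist G\<^sub>0) g)) \<and>
         (\<forall>\<xi>\<in>characters. \<forall>h\<in>AP. twist G\<^sub>0 h \<in> twisted_ap_flexes G\<^sub>0 \<longrightarrow>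
           symmetric_vector G\<^sub>0 \<xi> (fourier_coeff h \<xi>) \<in> bounded_inf_flexes G\<^sub>0)"
proof -
  note G = assms(2)
  have inv: "inv (twist G\<^sub>0) (twist G\<^sub>0 h) = h" for h
    using bij_twist[OF G] by (simp add: bij_is_inj)
  have ker: "orbit_matrix G\<^sub>0 \<xi> (fourier_coeff h \<xi>) = 0"
    if \<xi>: "\<xi> \<in> characters" and h: "h \<in> AP" "twist G\<^sub>0 h \<in> bounded_inf_flexes G\<^sub>0" for \<xi> h
  proof -
    obtain c where "has_fourier_coeff h \<xi> c"
      using AP_has_fourier_coeff[OF assms(1) h(1) \<xi>] by blast
    then show ?thesis
      using orbit_matrix_fourier_coeff[OF assms(1) G h(2) _ \<xi>]
        fourier_coeff_eqI[OF assms(1)] by metis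
  qed
  \<comment> \<open>Knowing that 0 lies in the kernel turns
    \<open>{a. orbit_matrix G\<^sub>0 \<xi> a = 0} \<noteq> {0}\<close> into the existence of a
    nonzero kernel vector.\<close>
  have zero: "orbit_matrix G\<^sub>0 \<xi> 0 = 0" if "\<xi> \<in> characters" for \<xi>
  proof -
    have "edge_map G\<^sub>0 e (0 - \<xi> (gain G\<^sub>0 e) *\<^sub>C dtau G\<^sub>0 (gain G\<^sub>0 e) 0) = 0"
      if e: "e \<in> arcs (graph G\<^sub>0)" for e
    proof -
      interpret \<phi>: Vector_Spaces.linear scaleC scaleC "edge_map G\<^sub>0 e"
        using G e by (simp add: is_gain_framework_def)
      interpret D: Vector_Spaces.linear scaleC scaleC "dtau G\<^sub>0 (gain G\<^sub>0 e)"
        by (rule dtau_Isom(1)[OF G])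
      show ?thesis by (simp add: D.zero \<phi>.zero)
    qed
    then show ?thesis by (simp add: orbit_matrix_eq_0_iff)
  qed
  have "rum_spectrum G\<^sub>0 = (\<Union>g\<in>twisted_ap_flexes G\<^sub>0. bohr_fourier_spectrum (inv (twist G\<^sub>0) g))"
  proof (intro equalityI subsetI)
    fix \<xi> assume "\<xi> \<in> rum_spectrum G\<^sub>0"
    then have \<xi>: "\<xi> \<in> characters" and "{a. orbit_matrix G\<^sub>0 \<xi> a = 0} \<noteq> {0}"
      by (auto simp: rum_spectrum_def)
    then obtain a where a: "a \<noteq> 0" "orbit_matrix G\<^sub>0 \<xi> a = 0"
      using zero[OF \<xi>] by blast
    \<comment> \<open>The one-term trigonometric polynomial through a kernel vector: its twist is
      the symmetric vector of \<open>a\<close>, and its coefficient at \<xi> is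
      \<open>a \<noteq> 0\<close>.\<close>
    define h where "h = Bcontfun (\<lambda>\<gamma>. \<xi> \<gamma> *\<^sub>C a)"
    have h: "apply_bcontfun h = (\<lambda>\<gamma>. \<xi> \<gamma> *\<^sub>C a)"
      unfolding h_def by (rule character_scaleC_bcontfun[OF \<xi>])
    have "h \<in> trig_polys"
      using \<xi> unfolding trig_polys_def
      by (intro CollectI exI[of _ "1::nat"] exI[of _ "\<lambda>_. \<xi>"] exI[of _ "\<lambda>_. a"]) (simp add: h)
    then have "h \<in> AP"
      using closure_subset by (auto simp: AP_def)
    moreover have "twist G\<^sub>0 h \<in> bounded_inf_flexes G\<^sub>0"
      using a(2) symmetric_vector_flex_iff[OF G \<xi>] symmetric_vector_eq_twist[OF G \<xi>]
      by (simp add: h_def)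
    ultimately have "twist G\<^sub>0 h \<in> twisted_ap_flexes G\<^sub>0"
      by (auto simp: twisted_ap_flexes_def)
    moreover have "fourier_coeff h \<xi> = a"
      using has_fourier_coeff_character[OF \<xi> \<xi>, of a]
      by (intro fourier_coeff_eqI[OF assms(1)]) (simp add: h)
    then have "\<xi> \<in> bohr_fourier_spectrum (inv (twist G\<^sub>0) (twist G\<^sub>0 h))"
      using \<xi> a(1) by (simp add: inv bohr_fourier_spectrum_def)
    ultimately show "\<xi> \<in> (\<Union>g\<in>twisted_ap_flexes G\<^sub>0. bohr_fourier_spectrum (inv (twist G\<^sub>0) g))"
      by blast
  next
    fix \<xi> assume "\<xi> \<in> (\<Union>g\<in>twisted_ap_flexes G\<^sub>0. bohr_fourier_spectrum (inv (twist G\<^sub>0) g))"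
    then obtain h where "h \<in> AP" "twist G\<^sub>0 h \<in> bounded_inf_flexes G\<^sub>0"
      "\<xi> \<in> characters" "fourier_coeff h \<xi> \<noteq> 0"
      by (auto simp: twisted_ap_flexes_def bohr_fourier_spectrum_def inv)
    \<comment> \<open>The nonzero Fourier coefficient is itself the required kernel vector.\<close>
    then show "\<xi> \<in> rum_spectrum G\<^sub>0"
      using ker by (auto simp: rum_spectrum_def)
  qed
  moreover have "symmetric_vector G\<^sub>0 \<xi> (fourier_coeff h \<xi>) \<in> bounded_inf_flexes G\<^sub>0"
    if "\<xi> \<in> characters" "h \<in> AP" "twist G\<^sub>0 h \<in> twisted_ap_flexes G\<^sub>0" for \<xi> h
    using that ker symmetric_vector_flex_iff[OF G] by (auto simp: twisted_ap_flexes_def)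
  ultimately show ?thesis by blast
qed

end
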